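(* Let $\theta=(\theta_1,\dots,\theta_N)$ be a vector with positive entries such that $$\forall m\in\mathcal S^{c}_{N,M-1},\quad \forall j\in A(m),\qquad \sum_{i\in A(m)}\theta_i\,p_{ij}(m)=\theta_j .$$ Then the continuous-time Markov process with state space $\mathcal S^{c}_{N,M}$ and transitions $$n\longrightarrow n-e_i+e_j\quad\text{at rate}\quad g_i(n_i)\,p_{ij}(n-e_i)\,\mathbf 1_{\{n_i>0,\ n_j<c_j\}}\qquad (n\in\mathcal S^{c}_{N,M},\ 1\le i\neq j\le N)$$ has as invariant distribution the probability measure $$\pi(n_1,\dots,n_N)=\frac1Z\prod_{j=1}^N\frac{\theta_j^{n_j}}{(g_j!)(n_j)},\qquad (n_1,\dots,n_N)\in\mathcal S^{c}_{N,M},$$ where $Z$ is the normalizing constant.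
   Context: $\mathbb N=\{0,1,2,\dots\}$. $N\ge1$ is the number of nodes, $M\ge1$ the number of customers, and $c=(c_1,\dots,c_N)$ with $c_i\in\mathbb N\cup\{+\infty\}$ are the node capacities, with $\sum_j c_j\ge M$. For an integer $L\ge 0$, $$\mathcal S^{c}_{N,L}=\Big\{(n_1,\dots,n_N)\in\mathbb N^N:\ \sum_{j=1}^N n_j=L\ \text{ and } n_j\le c_j \text{ whenever } c_j<+\infty\Big\}.$$ $e_i$ is the $i$-th unit vector of $\mathbb N^N$. For each node $i$, $g_i:\mathbb N\to[0,\infty)$ satisfies $g_i(0)=0$ and $g_i(k)>0$ for $k\ge1$; $(g_i!)(0)=1$ and $(g_i!)(n)=\prod_{k=1}^n g_i(k)$ for $n\ge1$. For $m\in\mathcal S^{c}_{N,M-1}$, $A(m)=\{j: 1\le j\le N,\ m_j<c_j\}$, and with each such $m$ is associated a (stochastic) transition matrix $P(m)=(p_{ij}(m))_{i,j\in A(m)}$ on the set $A(m)$. (If $n\in\mathcal S^c_{N,M}$, $n_i>0$ and $n_j<c_j$, then $i$ and $j$ belong to $A(n-e_i)$, so that $p_{ij}(n-e_i)$ is defined; the rate is $0$ when the indicator vanishes.) *)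

theory Defs
  imports "HOL-Analysis.Analysis" "HOL-Library.Extended_Nat"
begin

section \<open>Finite-state continuous-time Markov processes\<close>

text \<open>
  A process on a finite set \<open>S\<close> is given by its jump rates \<open>q x y\<close> for \<open>x \<noteq> y\<close>; values of \<open>q\<close> on
  the diagonal or outside \<open>S\<close> are ignored.  Its transition function is the matrix exponential
  \<open>P t = exp (t Q)\<close>.  All matrices are indexed by \<open>S\<close>.
\<close>

definition generator :: "'s set \<Rightarrow> ('s \<Rightarrow> 's \<Rightarrow> real) \<Rightarrow> 's \<Rightarrow> 's \<Rightarrow> real" where
  "generator S q x y = (if x = y then - (\<Sum>z\<in>S - {x}. q x z) else q x y)"

primrec matpow :: "'s set \<Rightarrow> ('s \<Rightarrow> 's \<Rightarrow> real) \<Rightarrow> nat \<Rightarrow> 's \<Rightarrow> 's \<Rightarrow> real" where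
  "matpow S A 0 x y = of_bool (x = y)"
| "matpow S A (Suc k) x y = (\<Sum>z\<in>S. A x z * matpow S A k z y)"

definition transition_function ::
    "'s set \<Rightarrow> ('s \<Rightarrow> 's \<Rightarrow> real) \<Rightarrow> real \<Rightarrow> 's \<Rightarrow> 's \<Rightarrow> real" where
  "transition_function S q t x y = (\<Sum>k. matpow S (generator S q) k x y / fact k * t ^ k)"

definition invariant_distribution :: "'s set \<Rightarrow> ('s \<Rightarrow> 's \<Rightarrow> real) \<Rightarrow> ('s \<Rightarrow> real) \<Rightarrow> bool" where
  "invariant_distribution S q \<mu> \<longleftrightarrow>
     (\<forall>x\<in>S. 0 \<le> \<mu> x) \<and> (\<Sum>x\<in>S. \<mu> x) = 1 \<and>
     (\<forall>t\<ge>0. \<forall>y\<in>S. (\<Sum>x\<in>S. \<mu> x * transition_function S q t x y) = \<mu> y)"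

text \<open>
  The exponential series converges, and the transition function is the solution of the
  Kolmogorov backward equation with the identity as initial value.
\<close>

lemma matpow_bound:
  assumes "finite S"
  shows "\<exists>C\<ge>0. \<forall>k. \<forall>x\<in>S. \<bar>matpow S A k x y\<bar> \<le> C ^ k"
proof -
  define C where "C = (\<Sum>x\<in>S. \<Sum>z\<in>S. \<bar>A x z\<bar>)"
  have C0: "C \<ge> 0" unfolding C_def by (intro sum_nonneg) auto
  have "\<forall>x\<in>S. \<bar>matpow S A k x y\<bar> \<le> C ^ k" for k
  proof (induction k)
    case 0 then show ?case by simp
  next
    case (Suc k)
    show ?case
    proof
      fix x assume x: "x \<in> S"
      have "\<bar>matpow S A (Suc k) x y\<bar> \<le> (\<Sum>z\<in>S. \<bar>A x z * matpow S A k z y\<bar>)"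
        by (simp add: sum_abs)
      also have "\<dots> \<le> (\<Sum>z\<in>S. \<bar>A x z\<bar> * C ^ k)"
        using Suc by (intro sum_mono) (auto simp: abs_mult intro!: mult_left_mono)
      also have "\<dots> = (\<Sum>z\<in>S. \<bar>A x z\<bar>) * C ^ k" by (simp add: sum_distrib_right)
      also have "\<dots> \<le> C * C ^ k"
        unfolding C_def[symmetric]
        using C0 member_le_sum[OF x, of "\<lambda>x. \<Sum>z\<in>S. \<bar>A x z\<bar>"] assms
        by (intro mult_right_mono) (auto simp: C_def sum_nonneg)
      finally show "\<bar>matpow S A (Suc k) x y\<bar> \<le> C ^ Suc k" by simp
    qed
  qed
  then show ?thesis using C0 by blast
qed

lemma summable_matpow:
  assumes "finite S" "x \<in> S"
  shows "summable (\<lambda>k. matpow S A k x y / fact k * (t::real) ^ k)"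
proof -
  obtain C where C: "C \<ge> 0" "\<And>k x. x \<in> S \<Longrightarrow> \<bar>matpow S A k x y\<bar> \<le> C ^ k"
    using matpow_bound[OF assms(1)] by blast
  show ?thesis
  proof (rule summable_comparison_test'[of "\<lambda>k. inverse (fact k) * (C * \<bar>t\<bar>) ^ k" 0])
    show "summable (\<lambda>k. inverse (fact k) * (C * \<bar>t\<bar>) ^ k)" by (rule summable_exp)
    show "norm (matpow S A k x y / fact k * t ^ k) \<le> inverse (fact k) * (C * \<bar>t\<bar>) ^ k" for k
      using mult_right_mono[OF C(2)[OF assms(2)], of "\<bar>t\<bar> ^ k / fact k" k]
      by (simp add: abs_mult power_abs power_mult_distrib field_simps)
  qed
qed

lemma transition_function_0: "transition_function S q 0 x y = of_bool (x = y)"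
  unfolding transition_function_def
  using powser_sums_zero[of "\<lambda>k. matpow S (generator S q) k x y / fact k"]
  by (simp add: sums_iff)

lemma kolmogorov_backward:
  assumes "finite S" "x \<in> S"
  shows "((\<lambda>t. transition_function S q t x y) has_real_derivative
           (\<Sum>z\<in>S. generator S q x z * transition_function S q t z y)) (at t)"
proof -
  let ?Q = "generator S q"
  have "((\<lambda>t. transition_function S q t x y) has_real_derivative
          (\<Sum>k. diffs (\<lambda>k. matpow S ?Q k x y / fact k) k * t ^ k)) (at t)"
    unfolding transition_function_def
    by (rule termdiffs_strong_converges_everywhere) (rule summable_matpow[OF assms])
  also have "(\<Sum>k. diffs (\<lambda>k. matpow S ?Q k x y / fact k) k * t ^ k)
      = (\<Sum>k. \<Sum>z\<in>S. ?Q x z * (matpow S ?Q k z y / fact k * t ^ k))"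
  proof (rule arg_cong[where f = suminf], rule ext)
    fix k
    have "diffs (\<lambda>k. matpow S ?Q k x y / fact k) k = matpow S ?Q (Suc k) x y / fact k"
      by (simp add: diffs_def field_simps del: matpow.simps of_nat_Suc)
    then show "diffs (\<lambda>k. matpow S ?Q k x y / fact k) k * t ^ k
      = (\<Sum>z\<in>S. ?Q x z * (matpow S ?Q k z y / fact k * t ^ k))"
      by (simp add: sum_distrib_right sum_divide_distrib mult.assoc)
  qed
  also have "\<dots> = (\<Sum>z\<in>S. ?Q x z * transition_function S q t z y)"
  proof -
    have "(\<Sum>k. \<Sum>z\<in>S. ?Q x z * (matpow S ?Q k z y / fact k * t ^ k))
        = (\<Sum>z\<in>S. \<Sum>k. ?Q x z * (matpow S ?Q k z y / fact k * t ^ k))"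
      by (rule suminf_sum) (rule summable_mult[OF summable_matpow[OF assms(1)]])
    also have "\<dots> = (\<Sum>z\<in>S. ?Q x z * transition_function S q t z y)"
      unfolding transition_function_def
      by (intro sum.cong refl suminf_mult summable_matpow[OF assms(1)])
    finally show ?thesis .
  qed
  finally show ?thesis .
qed

section \<open>The closed network\<close>

text \<open>
  Nodes are the elements of a finite type \<open>'n\<close>, so \<open>N = CARD('n)\<close>; \<open>\<infinity>\<close> is an allowed
  capacity; \<open>e\<^sub>i\<close> is \<open>axis i 1\<close>.
\<close>

definition states :: "('n::finite \<Rightarrow> enat) \<Rightarrow> nat \<Rightarrow> (nat ^ 'n) set" where
  "states c L = {n. (\<Sum>j\<in>UNIV. n $ j) = L \<and> (\<forall>j. enat (n $ j) \<le> c j)}"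

definition available :: "('n::finite \<Rightarrow> enat) \<Rightarrow> nat ^ 'n \<Rightarrow> 'n set" where
  "available c m = {j. enat (m $ j) < c j}"

definition stochastic_on :: "'i set \<Rightarrow> ('i \<Rightarrow> 'i \<Rightarrow> real) \<Rightarrow> bool" where
  "stochastic_on A P \<longleftrightarrow>
     (\<forall>i\<in>A. \<forall>j\<in>A. 0 \<le> P i j) \<and> (\<forall>i\<in>A. (\<Sum>j\<in>A. P i j) = 1)"

definition gfact :: "(nat \<Rightarrow> real) \<Rightarrow> nat \<Rightarrow> real" where
  "gfact g n = (\<Prod>k=1..n. g k)"

text \<open>
  The rate of the transition \<open>n \<rightarrow> n - e\<^sub>i + e\<^sub>j\<close>.  The subtraction is truncated on \<open>nat\<close>, but is
  only evaluated in the case \<open>n\<^sub>i > 0\<close>.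
\<close>

definition move_rate ::
    "('n::finite \<Rightarrow> enat) \<Rightarrow> ('n \<Rightarrow> nat \<Rightarrow> real) \<Rightarrow> (nat ^ 'n \<Rightarrow> 'n \<Rightarrow> 'n \<Rightarrow> real) \<Rightarrow>
     nat ^ 'n \<Rightarrow> 'n \<Rightarrow> 'n \<Rightarrow> real" where
  "move_rate c g p n i j =
     (if n $ i > 0 \<and> enat (n $ j) < c j then g i (n $ i) * p (n - axis i 1) i j else 0)"

definition network_rate ::
    "('n::finite \<Rightarrow> enat) \<Rightarrow> ('n \<Rightarrow> nat \<Rightarrow> real) \<Rightarrow> (nat ^ 'n \<Rightarrow> 'n \<Rightarrow> 'n \<Rightarrow> real) \<Rightarrow>
     nat ^ 'n \<Rightarrow> nat ^ 'n \<Rightarrow> real" where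
  "network_rate c g p n n' =
     (\<Sum>(i, j) | i \<noteq> j \<and> n' = n - axis i 1 + axis j 1. move_rate c g p n i j)"

definition product_weight ::
    "('n::finite \<Rightarrow> nat \<Rightarrow> real) \<Rightarrow> ('n \<Rightarrow> real) \<Rightarrow> nat ^ 'n \<Rightarrow> real" where
  "product_weight g \<theta> n = (\<Prod>j\<in>UNIV. \<theta> j ^ (n $ j) / gfact (g j) (n $ j))"

definition normalizing_constant ::
    "('n::finite \<Rightarrow> enat) \<Rightarrow> nat \<Rightarrow> ('n \<Rightarrow> nat \<Rightarrow> real) \<Rightarrow> ('n \<Rightarrow> real) \<Rightarrow> real" where
  "normalizing_constant c M g \<theta> = (\<Sum>n\<in>states c M. product_weight g \<theta> n)"

text \<open>The sums over \<open>states c L\<close> are finite, and the moves of positive rate stay inside.\<close>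

lemma finite_states: "finite (states (c :: 'n::finite \<Rightarrow> enat) L)"
proof (rule finite_imageD)
  show "finite (vec_nth ` states c L)"
  proof (rule finite_subset)
    show "vec_nth ` states c L \<subseteq> (UNIV \<rightarrow>\<^sub>E {..L})"
    proof
      fix v assume "v \<in> vec_nth ` states c L"
      then obtain n where v: "v = vec_nth n" and n: "n \<in> states c L" by blast
      have "n $ j \<le> L" for j
        using n member_le_sum[of j UNIV "\<lambda>j. n $ j"] by (auto simp: states_def)
      then show "v \<in> (UNIV \<rightarrow>\<^sub>E {..L})" using v by (auto simp: PiE_def)
    qed
  qed (auto intro: finite_PiE)
  show "inj_on vec_nth (states c L)" by (auto intro!: inj_onI simp: vec_eq_iff)
qed

lemma move_in_states:
  assumes "n \<in> states c M" "i \<noteq> j" "n $ i > 0" "enat (n $ j) < c j"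
  shows "n - axis i 1 + axis j 1 \<in> states c M"
proof -
  have val: "(n - axis i 1 + axis j 1) $ k + of_bool (k = i) = n $ k + of_bool (k = j)" for k
    using assms(2,3) by (auto simp: axis_def)
  have "(\<Sum>k\<in>UNIV. (n - axis i 1 + axis j 1) $ k) + 1 = (\<Sum>k\<in>UNIV. n $ k) + 1"
  proof -
    have "(\<Sum>k\<in>UNIV. (n - axis i 1 + axis j 1) $ k + of_bool (k = i))
        = (\<Sum>k\<in>UNIV. n $ k + of_bool (k = j))"
      by (intro sum.cong refl val)
    then show ?thesis
      unfolding sum.distrib by (simp add: of_bool_def del: vector_add_component vector_minus_component)
  qed
  moreover have "enat ((n - axis i 1 + axis j 1) $ k) \<le> c k" for k
  proof (cases "k = j")
    case True
    then show ?thesis using assms(2,4) by (simp add: axis_def Suc_ile_eq)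
  next
    case False
    then have "(n - axis i 1 + axis j 1) $ k \<le> n $ k" using val[of k] by simp
    moreover have "enat (n $ k) \<le> c k" using assms(1) by (simp add: states_def)
    ultimately show ?thesis by (meson enat_ord_simps(1) order_trans)
  qed
  ultimately show ?thesis using assms(1) by (simp add: states_def)
qed

end

theory Submission
  imports Defs
begin

text \<open>
  A move from \<open>n\<close> to \<open>n - e\<^sub>i + e\<^sub>j\<close> passes through the configuration \<open>m = n - e\<^sub>i\<close> with
  \<open>M - 1\<close> customers, and \<open>\<pi> (m + e\<^sub>i) g\<^sub>i(m\<^sub>i + 1) = \<pi> m \<theta>\<^sub>i\<close> for the unnormalized product
  weight \<open>\<pi>\<close>.  Hence the stationary flow along the move is \<open>\<pi> m \<theta>\<^sub>i p\<^sub>i\<^sub>j(m)\<close>, and for each fixed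
  \<open>m\<close> these flows balance at every \<open>m + e\<^sub>j\<close>, because \<open>\<theta>\<close> is invariant for \<open>P(m)\<close>.  Summation over
  \<open>m\<close> gives the global balance equations, that is \<open>\<pi> Q = 0\<close>, and thus \<open>\<pi> exp (t Q) = \<pi>\<close>.
\<close>

section \<open>Invariance from the balance equations\<close>

text \<open>In the exponential series, each term of order at least 1 has \<mu> Q as its leftmost
  factor and vanishes; only the identity term survives.\<close>

lemma balance_imp_transition_function_fixed:
  assumes fin: "finite S"
    and balance: "\<And>y. y \<in> S \<Longrightarrow> (\<Sum>x\<in>S. \<mu> x * generator S q x y) = 0"
    and y: "y \<in> S"
  shows "(\<Sum>x\<in>S. \<mu> x * transition_function S q t x y) = \<mu> y"
proof -
  let ?P = "matpow S (generator S q)"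
  \<comment> \<open>\<open>matpow\<close> splits off its new factor on the left, so exchanging the
    two sums exposes \<mu> Q.\<close>
  have Suc: "(\<Sum>x\<in>S. \<mu> x * ?P (Suc k) x y) = 0" for k
  proof -
    have "(\<Sum>x\<in>S. \<mu> x * ?P (Suc k) x y)
        = (\<Sum>z\<in>S. (\<Sum>x\<in>S. \<mu> x * generator S q x z) * ?P k z y)"
      by (simp add: sum_distrib_left sum_distrib_right mult.assoc) (rule sum.swap)
    then show ?thesis using balance by simp
  qed
  have coeff: "(\<Sum>x\<in>S. \<mu> x * ?P k x y) = (if k = 0 then \<mu> y else 0)" for k
    using Suc fin y by (cases k) (simp_all add: of_bool_def if_distrib cong: if_cong)
  have "(\<Sum>x\<in>S. \<mu> x * transition_function S q t x y)
      = (\<Sum>x\<in>S. \<Sum>k. \<mu> x * (?P k x y / fact k * t ^ k))"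
    unfolding transition_function_def
    by (intro sum.cong refl suminf_mult[symmetric] summable_matpow[OF fin])
  also have "\<dots> = (\<Sum>k. \<Sum>x\<in>S. \<mu> x * (?P k x y / fact k * t ^ k))"
    by (rule suminf_sum[symmetric]) (rule summable_mult[OF summable_matpow[OF fin]])
  also have "\<dots> = (\<Sum>k. (\<Sum>x\<in>S. \<mu> x * ?P k x y) / fact k * t ^ k)"
    by (simp only: sum_distrib_right sum_divide_distrib times_divide_eq_right mult.assoc
        times_divide_eq_left)
  also have "\<dots> = (\<Sum>k. (if k = 0 then \<mu> y else 0) / fact k * t ^ k)"
    by (simp only: coeff)
  also have "\<dots> = \<mu> y"
    using suminf_finite[of "{0}" "\<lambda>k. (if k = 0 then \<mu> y else 0) / fact k * t ^ k"] by simp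
  finally show ?thesis .
qed

text \<open>Each move \<open>k\<close> carries its rate from \<open>x\<close> to its target, which
  gives the difference of two indicators. Null moves with \<open>T k x = x\<close> cancel, in
  agreement with the ignored diagonal of \<open>q\<close>. By \<open>stay\<close>, the diagonal
  entry, a sum over \<open>S\<close> only, misses no move of nonzero rate.\<close>

lemma generator_moves:
  fixes r :: "'k \<Rightarrow> 's \<Rightarrow> real"
  assumes "finite S" "finite K" "x \<in> S"
    and stay: "\<And>k. k \<in> K \<Longrightarrow> r k x \<noteq> 0 \<Longrightarrow> T k x \<in> S"
    and q: "\<And>z. q x z = (\<Sum>k | k \<in> K \<and> z = T k x. r k x)"
  shows "generator S q x y = (\<Sum>k\<in>K. r k x * (of_bool (T k x = y) - of_bool (x = y)))"
proof -
  have q': "q x z = (\<Sum>k\<in>K. r k x * of_bool (T k x = z))" for z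
    unfolding q using \<open>finite K\<close> by (intro sum.mono_neutral_cong_left) auto
  show ?thesis
  proof (cases "x = y")
    case False
    then show ?thesis by (simp add: generator_def q')
  next
    case True
    have "(\<Sum>z\<in>S - {x}. q x z) = (\<Sum>k\<in>K. \<Sum>z\<in>S - {x}. r k x * of_bool (T k x = z))"
      unfolding q' by (rule sum.swap)
    also have "\<dots> = (\<Sum>k\<in>K. r k x * (1 - of_bool (T k x = x)))"
    proof (rule sum.cong[OF refl])
      \<comment> \<open>A move of rate zero may lead out of \<open>S\<close>, hence the case split
        on \<open>r k x = 0\<close>.\<close>
      fix k assume "k \<in> K"
      then show "(\<Sum>z\<in>S - {x}. r k x * of_bool (T k x = z)) = r k x * (1 - of_bool (T k x = x))"
        using stay[of k] \<open>finite S\<close>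
        by (cases "r k x = 0") (auto simp: of_bool_def if_distrib cong: if_cong)
    qed
    finally show ?thesis
      using True by (simp add: generator_def sum_negf[symmetric] algebra_simps)
  qed
qed

section \<open>Adding a customer\<close>

lemma states_add_axis:
  fixes c :: "'n::finite \<Rightarrow> enat"
  shows "m + axis i 1 \<in> states c (Suc L) \<longleftrightarrow> m \<in> states c L \<and> i \<in> available c m"
proof -
  have "(\<Sum>j\<in>UNIV. (m + axis i 1) $ j) = Suc (\<Sum>j\<in>UNIV. m $ j)"
    by (simp add: sum.distrib axis_def)
  moreover have "(\<forall>j. enat ((m + axis i 1) $ j) \<le> c j)
      \<longleftrightarrow> (\<forall>j. enat (m $ j) \<le> c j) \<and> enat (m $ i) < c i" (is "?l \<longleftrightarrow> ?r")
  proof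
    assume l: ?l
    then have "enat (m $ j) \<le> c j" for j
      using order_trans[of "enat (m $ j)" "enat ((m + axis i 1) $ j)" "c j"] by simp
    moreover have "enat (m $ i) < c i" using l[rule_format, of i] by (simp add: Suc_ile_eq)
    ultimately show ?r by blast
  next
    assume ?r then show ?l by (auto simp: axis_def Suc_ile_eq)
  qed
  ultimately show ?thesis by (auto simp: states_def available_def)
qed

lemma diff_axis_add_axis:
  fixes n :: "nat ^ 'n::finite"
  assumes "n $ i > 0"
  shows "n - axis i 1 + axis i 1 = n"
  using assms by (auto simp: vec_eq_iff axis_def)

text \<open>This makes the normalizing constant positive. Customers are placed one at a time: if
  every node were full, all capacities would be finite with sum \<open>L\<close>, too small for
  \<open>Suc L\<close>.\<close>

lemma states_nonempty:
  fixes c :: "'n::finite \<Rightarrow> enat"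
  assumes "enat L \<le> (\<Sum>j\<in>UNIV. c j)"
  shows "states c L \<noteq> {}"
  using assms
proof (induction L)
  case 0
  have "0 \<in> states c 0" by (simp add: states_def flip: zero_enat_def)
  then show ?case by blast
next
  case (Suc L)
  then obtain m where m: "m \<in> states c L"
    by (metis Suc_ile_eq ex_in_conv order_less_imp_le)
  have "available c m \<noteq> {}"
  proof
    assume "available c m = {}"
    then have "c j = enat (m $ j)" for j
      using m by (auto simp: available_def states_def not_less intro!: antisym)
    then have "(\<Sum>j\<in>UNIV. c j) = enat (\<Sum>j\<in>UNIV. m $ j)"
      by (simp add: of_nat_eq_enat[symmetric])
    then show False using m Suc.prems by (simp add: states_def)
  qed
  then show ?case using m states_add_axis by blast
qed

text \<open>Exchanges a sum over states and departure nodes for one over intermediate configurations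
  \<open>m\<close> and nodes with room. Keeping the node in the pair makes the map invertible; the
  truncated subtraction is exact because \<open>n $ i > 0\<close>.\<close>

lemma bij_betw_add_customer:
  fixes c :: "'n::finite \<Rightarrow> enat"
  shows "bij_betw (\<lambda>(m, i). (m + axis i 1, i))
           (SIGMA m:states c L. available c m) (SIGMA n:states c (Suc L). {i. n $ i > 0})"
proof (rule bij_betw_byWitness[where f' = "\<lambda>(n, i). (n - axis i 1, i)"])
  show "\<forall>a\<in>SIGMA m:states c L. available c m.
      (case case a of (m, i) \<Rightarrow> (m + axis i 1, i) of (n, i) \<Rightarrow> (n - axis i 1, i)) = a"
    by auto
  show "\<forall>a\<in>SIGMA n:states c (Suc L). {i. n $ i > 0}.
      (case case a of (n, i) \<Rightarrow> (n - axis i 1, i) of (m, i) \<Rightarrow> (m + axis i 1, i)) = a"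
    by (auto simp: diff_axis_add_axis simp del: One_nat_def)
  show "(\<lambda>(m, i). (m + axis i 1, i)) ` (SIGMA m:states c L. available c m)
      \<subseteq> (SIGMA n:states c (Suc L). {i. n $ i > 0})"
    by (auto simp: states_add_axis simp del: One_nat_def)
  show "(\<lambda>(n, i). (n - axis i 1, i)) ` (SIGMA n:states c (Suc L). {i. n $ i > 0})
      \<subseteq> (SIGMA m:states c L. available c m)"
  proof clarify
    fix n :: "nat ^ 'n" and i assume "n \<in> states c (Suc L)" "n $ i > 0"
    then show "n - axis i 1 \<in> states c L \<and> i \<in> available c (n - axis i 1)"
      using states_add_axis[of "n - axis i 1" i c L] by (simp only: diff_axis_add_axis)
  qed
qed

lemma product_weight_pos:
  assumes "\<And>i k. k \<ge> 1 \<Longrightarrow> g i k > 0" "\<And>j. \<theta> j > 0"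
  shows "product_weight g \<theta> n > 0"
  unfolding product_weight_def gfact_def
  using assms by (intro prod_pos) (auto intro!: divide_pos_pos prod_pos)

text \<open>Only the factor at node \<open>i\<close> changes: it gains
  \<open>\<theta> i / g i (Suc (m $ i))\<close>, whose denominator cancels the service rate.\<close>

lemma product_weight_add_axis:
  assumes "g i (Suc (m $ i)) \<noteq> 0"
  shows "product_weight g \<theta> (m + axis i 1) * g i (Suc (m $ i)) = product_weight g \<theta> m * \<theta> i"
proof -
  let ?h = "\<lambda>n j. \<theta> j ^ (n $ j) / gfact (g j) (n $ j)"
  have eq: "product_weight g \<theta> n = ?h n i * (\<Prod>j\<in>UNIV - {i}. ?h n j)" for n
    unfolding product_weight_def by (rule prod.remove) auto
  have rest: "(\<Prod>j\<in>UNIV - {i}. ?h (m + axis i 1) j) = (\<Prod>j\<in>UNIV - {i}. ?h m j)"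
    by (intro prod.cong) (auto simp: axis_def)
  have "?h (m + axis i 1) i * g i (Suc (m $ i)) = ?h m i * \<theta> i"
    using assms by (simp add: gfact_def)
  moreover have "a * r * x = b * r * t" if "a * x = b * t" for a b r t x :: real
    using that by algebra
  ultimately show ?thesis unfolding eq rest by blast
qed

section \<open>The balance equations of the network\<close>

text \<open>Moves are indexed by ordered pairs of distinct nodes. Empty departure nodes have rate
  zero and are dropped, so that the index set fits \<open>bij_betw_add_customer\<close>.\<close>

lemma generator_network:
  fixes c :: "'n::finite \<Rightarrow> enat"
  assumes "n \<in> states c M"
  shows "generator (states c M) (network_rate c g p) n y =
    (\<Sum>i\<in>{i. n $ i > 0}. \<Sum>j\<in>-{i}. move_rate c g p n i j *
       (of_bool (n - axis i 1 + axis j 1 = y) - of_bool (n = y)))"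
proof -
  let ?T = "\<lambda>(i, j) n. n - axis i 1 + axis j 1" and ?r = "\<lambda>(i, j) n. move_rate c g p n i j"
  have "generator (states c M) (network_rate c g p) n y =
    (\<Sum>k\<in>(SIGMA i:UNIV. -{i}). ?r k n * (of_bool (?T k n = y) - of_bool (n = y)))"
  proof (rule generator_moves[OF finite_states _ assms])
    fix k :: "'n \<times> 'n" assume k: "k \<in> (SIGMA i:UNIV. -{i})" "?r k n \<noteq> 0"
    obtain i j where ij: "k = (i, j)" by (cases k)
    show "?T k n \<in> states c M"
      using k move_in_states[OF assms, of i j] by (simp add: ij move_rate_def split: if_splits)
  qed (auto simp: network_rate_def intro!: sum.cong)
  also have "\<dots> = (\<Sum>i\<in>UNIV. \<Sum>j\<in>-{i}. move_rate c g p n i j *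
       (of_bool (n - axis i 1 + axis j 1 = y) - of_bool (n = y)))"
    by (subst sum.Sigma) (simp_all add: case_prod_unfold)
  also have "\<dots> = (\<Sum>i\<in>{i. n $ i > 0}. \<Sum>j\<in>-{i}. move_rate c g p n i j *
       (of_bool (n - axis i 1 + axis j 1 = y) - of_bool (n = y)))"
    by (rule sum.mono_neutral_right) (auto simp: move_rate_def)
  finally show ?thesis .
qed

lemma flow_through:
  fixes c :: "'n::finite \<Rightarrow> enat"
  assumes "g i (Suc (m $ i)) \<noteq> 0"
  shows "(\<Sum>j\<in>-{i}. product_weight g \<theta> (m + axis i 1) * (move_rate c g p (m + axis i 1) i j *
            (of_bool (m + axis j 1 = y) - of_bool (m + axis i 1 = y))))
       = (\<Sum>j\<in>available c m. product_weight g \<theta> m * \<theta> i * p m i j *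
            (of_bool (m + axis j 1 = y) - of_bool (m + axis i 1 = y)))"
    (is "?l = sum ?F _")
proof -
  have "?l = sum ?F (available c m - {i})"
  proof (rule sum.mono_neutral_cong_right)
    fix j assume "j \<in> available c m - {i}"
    then have "move_rate c g p (m + axis i 1) i j = g i (Suc (m $ i)) * p m i j"
      by (simp add: move_rate_def available_def axis_def)
    then show "product_weight g \<theta> (m + axis i 1) * (move_rate c g p (m + axis i 1) i j *
        (of_bool (m + axis j 1 = y) - of_bool (m + axis i 1 = y))) = ?F j"
      unfolding product_weight_add_axis[of g i m \<theta>, OF assms, symmetric] by (simp add: mult.assoc)
  qed (auto simp: move_rate_def available_def axis_def)
  \<comment> \<open>The term \<open>j = i\<close> is zero because its two indicators coincide.
    Including it gives the full sums over \<open>available c m\<close> that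
    \<open>local_balance\<close> needs.\<close>
  also have "\<dots> = sum ?F (available c m)"
    by (rule sum.mono_neutral_left) auto
  finally show ?thesis .
qed

text \<open>The \<open>f j\<close> part collapses by invariance of \<open>\<theta>\<close>, the
  \<open>f i\<close> part because rows sum to 1; both equal the sum of
  \<open>\<theta> i * f i\<close>.\<close>

lemma local_balance:
  fixes P :: "'i \<Rightarrow> 'i \<Rightarrow> real"
  assumes "stochastic_on A P"
    and "\<And>j. j \<in> A \<Longrightarrow> (\<Sum>i\<in>A. \<theta> i * P i j) = \<theta> j"
  shows "(\<Sum>i\<in>A. \<Sum>j\<in>A. \<theta> i * P i j * (f j - f i)) = 0"
proof -
  have "(\<Sum>i\<in>A. \<Sum>j\<in>A. \<theta> i * P i j * f j) = (\<Sum>j\<in>A. (\<Sum>i\<in>A. \<theta> i * P i j) * f j)"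
    unfolding sum_distrib_right by (rule sum.swap)
  also have "\<dots> = (\<Sum>j\<in>A. \<theta> j * f j)" using assms(2) by simp
  also have "\<dots> = (\<Sum>i\<in>A. \<theta> i * f i * (\<Sum>j\<in>A. P i j))"
    using assms(1) by (simp add: stochastic_on_def)
  also have "\<dots> = (\<Sum>i\<in>A. \<Sum>j\<in>A. \<theta> i * P i j * f i)"
    by (simp add: sum_distrib_left ac_simps)
  finally show ?thesis by (simp add: right_diff_distrib sum_subtractf)
qed

lemma network_balance:
  fixes c :: "'n::finite \<Rightarrow> enat"
  assumes g: "\<And>i k. k \<ge> 1 \<Longrightarrow> g i k > 0"
    and stoch: "\<And>m. m \<in> states c L \<Longrightarrow> stochastic_on (available c m) (p m)"
    and \<theta>: "\<And>m j. m \<in> states c L \<Longrightarrow> j \<in> available c m \<Longrightarrow>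
           (\<Sum>i\<in>available c m. \<theta> i * p m i j) = \<theta> j"
  shows "(\<Sum>n\<in>states c (Suc L). product_weight g \<theta> n *
            generator (states c (Suc L)) (network_rate c g p) n y) = 0"
proof -
  let ?w = "product_weight g \<theta>"
  \<comment> \<open>The net flow into \<open>y\<close> caused by departures from node
    \<open>i\<close> in state \<open>n\<close>.\<close>
  define G where "G = (\<lambda>(n, i). \<Sum>j\<in>-{i}. ?w n * (move_rate c g p n i j *
    (of_bool (n - axis i 1 + axis j 1 = y) - of_bool (n = y))))"
  have "(\<Sum>n\<in>states c (Suc L). ?w n * generator (states c (Suc L)) (network_rate c g p) n y)
      = (\<Sum>n\<in>states c (Suc L). \<Sum>i\<in>{i. n $ i > 0}. G (n, i))"
    by (simp add: generator_network G_def sum_distrib_left)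
  also have "\<dots> = sum G (SIGMA n:states c (Suc L). {i. n $ i > 0})"
    by (subst sum.Sigma) (auto simp: finite_states)
  also have "\<dots> = (\<Sum>(m, i)\<in>(SIGMA m:states c L. available c m). G (m + axis i 1, i))"
    by (subst sum.reindex_bij_betw[OF bij_betw_add_customer, symmetric])
      (simp add: case_prod_unfold)
  also have "\<dots> = (\<Sum>m\<in>states c L. \<Sum>i\<in>available c m. G (m + axis i 1, i))"
    by (subst sum.Sigma) (auto simp: finite_states)
  also have "\<dots> = (\<Sum>m\<in>states c L. ?w m * (\<Sum>i\<in>available c m. \<Sum>j\<in>available c m.
      \<theta> i * p m i j * (of_bool (m + axis j 1 = y) - of_bool (m + axis i 1 = y))))"
  proof (intro sum.cong refl)
    fix m
    have "G (m + axis i 1, i) = (\<Sum>j\<in>available c m. ?w m * \<theta> i * p m i j *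
            (of_bool (m + axis j 1 = y) - of_bool (m + axis i 1 = y)))" for i
      using flow_through[of g i m \<theta> c p y] g[of "Suc (m $ i)" i] by (simp add: G_def)
    then show "(\<Sum>i\<in>available c m. G (m + axis i 1, i)) =
      ?w m * (\<Sum>i\<in>available c m. \<Sum>j\<in>available c m.
      \<theta> i * p m i j * (of_bool (m + axis j 1 = y) - of_bool (m + axis i 1 = y)))"
      by (simp add: sum_distrib_left mult.assoc)
  qed
  \<comment> \<open>For each \<open>m\<close>, \<open>local_balance\<close> applies with
    \<open>f i\<close> the indicator of \<open>m + axis i 1 = y\<close>.\<close>
  also have "\<dots> = 0"
    using local_balance[OF stoch \<theta>] by (simp only: mult_zero_right sum.neutral_const cong: sum.cong)
  finally show ?thesis .
qed

theorem theorem3p2: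
  fixes c :: "'n::finite \<Rightarrow> enat"
    and M :: nat
    and g :: "'n \<Rightarrow> nat \<Rightarrow> real"
    and p :: "nat ^ 'n \<Rightarrow> 'n \<Rightarrow> 'n \<Rightarrow> real"
    and \<theta> :: "'n \<Rightarrow> real"
  assumes "M \<ge> 1"
    and "enat M \<le> (\<Sum>j\<in>UNIV. c j)"
    and "\<And>i. g i 0 = 0"
    and "\<And>i k. k \<ge> 1 \<Longrightarrow> g i k > 0"
    and "\<And>m. m \<in> states c (M - 1) \<Longrightarrow> stochastic_on (available c m) (p m)"
    and "\<And>j. \<theta> j > 0"
    and "\<And>m j. m \<in> states c (M - 1) \<Longrightarrow> j \<in> available c m \<Longrightarrow>
           (\<Sum>i\<in>available c m. \<theta> i * p m i j) = \<theta> j"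
  shows "invariant_distribution (states c M) (network_rate c g p)
           (\<lambda>n. 1 / normalizing_constant c M g \<theta> * product_weight g \<theta> n)"
proof -
  let ?S = "states c M" and ?Z = "normalizing_constant c M g \<theta>"
  have w: "product_weight g \<theta> n > 0" for n
    by (rule product_weight_pos) (use assms in auto)
  have Z: "?Z > 0"
    unfolding normalizing_constant_def
    by (intro sum_pos finite_states states_nonempty assms w)
  \<comment> \<open>\<open>M \<ge> 1\<close> turns \<open>Suc (M - 1)\<close> into
    \<open>M\<close>.\<close>
  have balance: "(\<Sum>n\<in>?S. product_weight g \<theta> n * generator ?S (network_rate c g p) n y) = 0" for y
    using network_balance[where L = "M - 1", OF assms(4,5,7)] \<open>M \<ge> 1\<close> by simp
  show ?thesis
    unfolding invariant_distribution_def
  proof (intro conjI ballI allI impI)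
    show "0 \<le> 1 / ?Z * product_weight g \<theta> n" for n
      using Z w[of n] by simp
    show "(\<Sum>n\<in>?S. 1 / ?Z * product_weight g \<theta> n) = 1"
      using Z by (simp add: sum_divide_distrib[symmetric] normalizing_constant_def[symmetric])
  next
    fix t y assume y: "y \<in> ?S"
    show "(\<Sum>n\<in>?S. 1 / ?Z * product_weight g \<theta> n *
        transition_function ?S (network_rate c g p) t n y) = 1 / ?Z * product_weight g \<theta> y"
    proof (rule balance_imp_transition_function_fixed[
          where \<mu> = "\<lambda>n. 1 / ?Z * product_weight g \<theta> n", OF finite_states _ y])
      show "(\<Sum>n\<in>?S. 1 / ?Z * product_weight g \<theta> n * generator ?S (network_rate c g p) n z) = 0"
        for z
        using balance[of z] by (simp add: sum_divide_distrib[symmetric])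
    qed
  qed
qed

end
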